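(* Let $K, N\ge 1$ be integers, let $\alpha=(\alpha_1,\dots,\alpha_K)$ with all $\alpha_k>0$, and put $\overline{\alpha}=\sum_{k=1}^K\alpha_k$, $\tilde\alpha=\alpha/\overline{\alpha}$. Let $Q^{(n)}_\alpha$ denote the $n$-th order moment tensor of the Dirichlet distribution $\mathrm{Dir}_\alpha$. Then $$Q^{(N)}_{\alpha} = \frac{1}{\overline{\alpha}^{[N]}}\left[\sum_{n=1}^{N}\overline{\alpha}^{\,n} \sum_{(S_1, \dots, S_n)\in\mathcal{P}(N,n)} \ \prod_{i=1}^{n} (|S_i|-1)!\; T_{(S_1, \dots, S_n)}\Big(\bigotimes_{i=1}^{n}\mathrm{diag}_{|S_i|}(\tilde{\alpha})\Big)\right].$$ Moreover, $$\mathrm{diag}_{N}(\tilde{\alpha}) = \frac{1}{(N-1)!\, \overline{\alpha}} \left[\sum_{n=1}^{N} (-1)^{n-1} (n-1)!\sum_{(S_1, \dots, S_n)\in\mathcal{P}(N,n)}\ \prod_{i=1}^{n} \overline{\alpha}^{[|S_i|]}\; T_{(S_1, \dots, S_n)} \Big(\bigotimes_{i=1}^{n}Q^{(|S_i|)}_{\alpha}\Big)\right].$$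
   Context: $a^{[n]}=a(a+1)\cdots(a+n-1)$ is the rising factorial, while $a^n$ is the usual power. The tensor $Q^{(n)}_\alpha\in\mathbb{R}^{K\times\cdots\times K}$ ($n$ times) has entries $Q^{(n)}_{\alpha,k_1\dots k_n}=\mathbb{E}_{q\sim\mathrm{Dir}_\alpha}[q_{k_1}\cdots q_{k_n}]$, $k_1,\dots,k_n\in\{1,\dots,K\}$. For $\beta\in\mathbb{R}^K$, $\mathrm{diag}_n(\beta)\in\mathbb{R}^{K\times\cdots\times K}$ ($n$ times) has entries $\mathrm{diag}_n(\beta)_{k_1\dots k_n}=\beta_{k_1}1_{(k_1=\dots=k_n)}$ (so $\mathrm{diag}_1(\beta)=\beta$). $\mathcal{P}(N,n)$ is the set of all partitions of $\{1,\dots,N\}$ into $n$ disjoint non-empty subsets $S_1,\dots,S_n$ (unordered: each set partition is counted once). $\bigotimes_i A^i$ is the outer product of tensors. For a permutation $\tau$ of $\{1,\dots,N\}$, $T_\tau(Q)_{k_1\dots k_N}=Q_{k_{\tau(1)}\dots k_{\tau(N)}}$. If $A^1,\dots,A^n$ are symmetric tensors of orders $|S_1|,\dots,|S_n|$, then $T_{(S_1,\dots,S_n)}(\bigotimes_{i}A^i)$ denotes $T_\tau(\bigotimes_i A^i)$ for any permutation $\tau$ sending the block of the first $|S_1|$ positions onto $S_1$, the next $|S_2|$ positions onto $S_2$, and so on (by symmetry the result does not depend on the choice of $\tau$); that is, its $(k_1,\dots,k_N)$ entry is $\prod_{i=1}^n A^i_{(k_s)_{s\in S_i}}$. *)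

theory Defs
  imports "HOL-Probability.Probability" "HOL-Combinatorics.Permutations"
begin

section \<open>The Dirichlet distribution\<close>

text \<open>A point of the simplex in coordinates \<open>1, \<dots>, K\<close> is determined by its first
  \<open>K - 1\<close> coordinates. The Dirichlet distribution has its usual density with respect to
  Lebesgue measure in these free coordinates. For \<open>K = 1\<close> the base measure is the
  unit point mass on the empty family, and the result is the point mass at \<open>1\<close>.\<close>

definition simplex_point :: "nat \<Rightarrow> (nat \<Rightarrow> real) \<Rightarrow> nat \<Rightarrow> real" where
  "simplex_point K x = x(K := 1 - (\<Sum>k\<in>{1..<K}. x k))"

definition dirichlet_density :: "nat \<Rightarrow> (nat \<Rightarrow> real) \<Rightarrow> (nat \<Rightarrow> real) \<Rightarrow> real" where
  "dirichlet_density K \<alpha> q =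
     (if \<forall>k\<in>{1..K}. q k > 0
      then Gamma (\<Sum>k=1..K. \<alpha> k) / (\<Prod>k=1..K. Gamma (\<alpha> k)) * (\<Prod>k=1..K. q k powr (\<alpha> k - 1))
      else 0)"

definition dirichlet :: "nat \<Rightarrow> (nat \<Rightarrow> real) \<Rightarrow> (nat \<Rightarrow> real) measure" where
  "dirichlet K \<alpha> =
     distr
       (density (PiM {1..<K} (\<lambda>_. lborel))
          (\<lambda>x. ennreal (dirichlet_density K \<alpha> (simplex_point K x))))
       (PiM {1..K} (\<lambda>_. borel))
       (simplex_point K)"


section \<open>Tensors\<close>

text \<open>A tensor of order \<open>n\<close> over \<open>{1..K}\<close> is given by its entries at the multi-indices
  \<open>ks\<close> with \<open>length ks = n\<close> and \<open>set ks \<subseteq> {1..K}\<close>; values at other lists are irrelevant.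
  The tensor positions \<open>1, \<dots>, N\<close> are numbered \<open>0, \<dots>, N - 1\<close>, following list indexing.\<close>

type_synonym tensor = "nat list \<Rightarrow> real"

definition moment_tensor :: "nat \<Rightarrow> (nat \<Rightarrow> real) \<Rightarrow> nat \<Rightarrow> tensor" where
  "moment_tensor K \<alpha> n ks = (\<integral>q. (\<Prod>i<n. q (ks ! i)) \<partial>dirichlet K \<alpha>)"

definition diag_tensor :: "nat \<Rightarrow> (nat \<Rightarrow> real) \<Rightarrow> tensor" where
  "diag_tensor n \<beta> ks = (if \<forall>i<n. ks ! i = ks ! 0 then \<beta> (ks ! 0) else 0)"

definition set_partitions :: "nat \<Rightarrow> nat \<Rightarrow> nat set set set" where
  "set_partitions N n = {P. partition_on {..<N} P \<and> card P = n}"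

text \<open>The outer product of the \<open>A S\<close>, \<open>S \<in> P\<close>, with the factor \<open>A S\<close> placed at the positions
  in \<open>S\<close>: here \<open>nths ks S\<close> is the sub-multi-index of \<open>ks\<close> at the positions in \<open>S\<close>.\<close>

definition block_tensor :: "nat set set \<Rightarrow> (nat set \<Rightarrow> tensor) \<Rightarrow> tensor" where
  "block_tensor P A ks = (\<Prod>S\<in>P. A S (nths ks S))"

text \<open>For symmetric factors, this is the ordinary outer product (factors of orders \<open>ms\<close> at
  consecutive positions) with its positions permuted by any \<open>\<tau>\<close> that sends the consecutive
  blocks onto the prescribed ones.\<close>

definition outer_product :: "nat list \<Rightarrow> tensor list \<Rightarrow> tensor" where
  "outer_product ms As js =
     (\<Prod>i<length ms. (As ! i) (take (ms ! i) (drop (sum_list (take i ms)) js)))"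

definition permute_tensor :: "nat \<Rightarrow> (nat \<Rightarrow> nat) \<Rightarrow> tensor \<Rightarrow> tensor" where
  "permute_tensor N \<tau> Q ks = Q (map (\<lambda>i. ks ! \<tau> i) [0..<N])"

lemma mset_nths_eq:
  "mset (nths ks S) = image_mset ((!) ks) (mset_set {i. i < length ks \<and> i \<in> S})"
proof (induction ks rule: rev_induct)
  case Nil
  then show ?case by simp
next
  case (snoc x xs)
  have "image_mset ((!) (xs @ [x])) (mset_set {i. i < length xs \<and> i \<in> S})
      = image_mset ((!) xs) (mset_set {i. i < length xs \<and> i \<in> S})"
    by (rule image_mset_cong) (auto simp: nth_append)
  moreover have "{i. i < length (xs @ [x]) \<and> i \<in> S} =
      (if length xs \<in> S then insert (length xs) {i. i < length xs \<and> i \<in> S}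
       else {i. i < length xs \<and> i \<in> S})"
    by (auto simp: less_Suc_eq)
  ultimately show ?case
    using snoc by (simp add: nths_append)
qed

lemma permute_outer_product_eq_block_tensor:
  fixes Ss :: "nat set list"
  defines "ms \<equiv> map card Ss"
  assumes P: "partition_on {..<N} (set Ss)" "distinct Ss"
    and sym: "\<And>S xs ys. S \<in> set Ss \<Longrightarrow> length xs = card S \<Longrightarrow> mset xs = mset ys \<Longrightarrow> A S xs = A S ys"
    and \<tau>: "\<tau> permutes {..<N}"
    and blocks: "\<And>i. i < length Ss \<Longrightarrow>
      \<tau> ` {sum_list (take i ms)..<sum_list (take (Suc i) ms)} = Ss ! i"
    and ks: "length ks = N"
  shows "permute_tensor N \<tau> (outer_product ms (map A Ss)) ks = block_tensor (set Ss) A ks"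
proof -
  have fin: "finite S" if "S \<in> set Ss" for S
    using that P(1) by (metis finite_lessThan finite_elements finite_subset partition_onD1 Sup_upper)
  have sum_ms: "sum_list ms = N"
  proof -
    have "sum_list ms = (\<Sum>S\<in>set Ss. card S)"
      unfolding ms_def using P(2) by (simp add: sum_list_distinct_conv_sum_set)
    also have "\<dots> = card (\<Union>(set Ss))"
      using P(1) fin by (intro card_Union_disjoint[symmetric])
        (auto simp: partition_on_def disjoint_def pairwise_def disjnt_def)
    also have "\<dots> = N"
      using P(1) by (simp add: partition_on_def)
    finally show ?thesis .
  qed
  have eq: "(map A Ss ! i) (take (ms ! i) (drop (sum_list (take i ms)) (map (\<lambda>i. ks ! \<tau> i) [0..<N])))
      = A (Ss ! i) (nths ks (Ss ! i))" if i: "i < length Ss" for i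
  proof -
    define b where "b = sum_list (take i ms)"
    have Si: "Ss ! i \<in> set Ss" using i by simp
    have suc: "sum_list (take (Suc i) ms) = b + ms ! i"
      using i by (simp add: take_Suc_conv_app_nth b_def ms_def)
    have le: "b + ms ! i \<le> N"
    proof -
      have "sum_list ms = sum_list (take (Suc i) ms) + sum_list (drop (Suc i) ms)"
        by (metis append_take_drop_id sum_list_append)
      then show ?thesis using sum_ms suc by simp
    qed
    have l: "take (ms ! i) (drop b (map (\<lambda>i. ks ! \<tau> i) [0..<N])) = map (\<lambda>i. ks ! \<tau> i) [b..<b + ms ! i]"
      using le by (simp add: take_map drop_map)
    have img: "\<tau> ` {b..<b + ms ! i} = Ss ! i"
      using blocks[OF i] suc by (simp add: b_def)
    have sub: "Ss ! i \<subseteq> {..<N}"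
      using Si P(1) by (auto simp: partition_on_def)
    have "mset (map (\<lambda>i. ks ! \<tau> i) [b..<b + ms ! i])
        = image_mset ((!) ks) (image_mset \<tau> (mset_set {b..<b + ms ! i}))"
      by (simp add: image_mset.compositionality comp_def)
    also have "image_mset \<tau> (mset_set {b..<b + ms ! i}) = mset_set (Ss ! i)"
      using permutes_inj[OF \<tau>] by (simp add: image_mset_mset_set inj_on_subset img)
    also have "Ss ! i = {j. j < length ks \<and> j \<in> Ss ! i}"
      using sub ks by auto
    finally have "mset (map (\<lambda>i. ks ! \<tau> i) [b..<b + ms ! i]) = mset (nths ks (Ss ! i))"
      by (simp add: mset_nths_eq)
    moreover have "length (map (\<lambda>i. ks ! \<tau> i) [b..<b + ms ! i]) = card (Ss ! i)"
      using i by (simp add: ms_def)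
    ultimately have "A (Ss ! i) (map (\<lambda>i. ks ! \<tau> i) [b..<b + ms ! i]) = A (Ss ! i) (nths ks (Ss ! i))"
      using sym[OF Si] by blast
    then show ?thesis using i l by (simp add: b_def)
  qed
  have "permute_tensor N \<tau> (outer_product ms (map A Ss)) ks
      = (\<Prod>i<length Ss. A (Ss ! i) (nths ks (Ss ! i)))"
    unfolding permute_tensor_def outer_product_def
    by (rule prod.cong) (use eq in \<open>auto simp: ms_def\<close>)
  also have "\<dots> = block_tensor (set Ss) A ks"
    unfolding block_tensor_def
    by (rule prod.reindex_bij_betw[OF bij_betw_nth[OF P(2)]]) auto
  finally show ?thesis .
qed

end

theory Submission
  imports Defs
begin

text \<open>
  Fix a multi-index \<open>k\<^sub>1, \<dots>, k\<^sub>N\<close> and regard it as a colouring of the positions; let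
  \<open>m\<^sub>c(S)\<close> be the number of positions of colour \<open>c\<close> in \<open>S\<close>. Both formulas relate two functions
  of a set \<open>S\<close> of positions. One is \<open>w(S) = (\<bar>S\<bar> - 1)! \<alpha>\<^sub>c\<close> if all of \<open>S\<close> has the
  colour \<open>c\<close>, and \<open>0\<close> otherwise: this is \<open>(\<bar>S\<bar> - 1)!\<close> times \<open>\<Sum>\<alpha>\<close> times the entry of the
  diagonal tensor at the positions in \<open>S\<close>. The other is
  \<open>f(S) = \<Prod>\<^sub>c \<alpha>\<^sub>c (\<alpha>\<^sub>c + 1) \<cdots> (\<alpha>\<^sub>c + m\<^sub>c(S) - 1)\<close>.

  The Dirichlet integral identifies \<open>f(S)\<close> as the rising factorial of \<open>\<Sum>\<alpha>\<close> of length
  \<open>\<bar>S\<bar>\<close> times the moment at the positions in \<open>S\<close> (\<open>moment_tensor_eq\<close>): multiplying the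
  density by a monomial only shifts its exponents, so a moment is a quotient of two normalising
  constants. These constants come from integrating out one coordinate at a time, each
  step being a Beta integral (\<open>nn_integral_dirichlet\<close>).

  The first formula is then \<open>f(A) = \<Sum>\<^sub>P \<Prod>\<^sub>S w(S)\<close>, summed over the partitions \<open>P\<close> of
  \<open>A\<close> (\<open>partition_sum_mono_weight\<close>). A new position \<open>b\<close> either is a block of its own, with
  weight \<open>\<alpha>\<^sub>c\<close> for its colour \<open>c\<close>, or it joins a block \<open>S\<close> of the same colour and multiplies
  its weight by \<open>\<bar>S\<bar>\<close>. In total the sum is multiplied by \<open>\<alpha>\<^sub>c + m\<^sub>c(A)\<close>, exactly like
  \<open>f\<close>; this is the seating rule of the Chinese restaurant process, or of the Polya urn.

  The second formula recovers \<open>w\<close> from \<open>f\<close>. It holds for every function \<open>w\<close> of sets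
  (\<open>moebius_sum_partition_sum\<close>) and is the inversion between moments and cumulants. Both
  \<open>w\<close> and the alternating sum over partitions solve the recursion
  \<open>f(A) = \<Sum>\<^sub>S w(S) f(A - S)\<close>, where \<open>S\<close> runs over the subsets of \<open>A\<close> that contain a fixed
  element \<open>a\<close>. As \<open>f\<close> of the empty set is \<open>1\<close>, this recursion determines \<open>w\<close>.
\<close>

section \<open>Sums over set partitions\<close>

text \<open>Double counting: a partition with a distinguished block is the same thing as a choice of that
  block together with a partition of its complement.\<close>

lemma sum_marked_partitions:
  fixes F :: "'a set \<Rightarrow> 'a set set \<Rightarrow> 'b::comm_monoid_add"
  assumes "finite A"
  shows "(\<Sum>Q | partition_on A Q. \<Sum>B | B \<in> Q \<and> c B. F B (Q - {B}))
       = (\<Sum>B | B \<subseteq> A \<and> B \<noteq> {} \<and> c B. \<Sum>P | partition_on (A - B) P. F B P)"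
proof -
  have fin: "finite Q" if "partition_on A Q" for Q
    using finite_elements[OF assms that] .
  have "(\<Sum>Q | partition_on A Q. \<Sum>B | B \<in> Q \<and> c B. F B (Q - {B}))
      = (\<Sum>(Q, B)\<in>(SIGMA Q:{Q. partition_on A Q}. {B. B \<in> Q \<and> c B}). F B (Q - {B}))"
    using assms fin by (intro sum.Sigma) (auto intro: finitely_many_partition_on)
  also have "\<dots> = (\<Sum>(B, P)\<in>(SIGMA B:{B. B \<subseteq> A \<and> B \<noteq> {} \<and> c B}. {P. partition_on (A - B) P}). F B P)"
  proof (rule sum.reindex_bij_witness[where i = "\<lambda>(B, P). (insert B P, B)" and j = "\<lambda>(Q, B). (B, Q - {B})"])
    fix q assume "q \<in> (SIGMA Q:{Q. partition_on A Q}. {B. B \<in> Q \<and> c B})"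
    then obtain Q B where q: "q = (Q, B)" "partition_on A Q" "B \<in> Q" "c B" by auto
    have "disjnt B (\<Union>(Q - {B}))"
      using q(2,3) by (auto simp: partition_on_def disjoint_def disjnt_def)
    from partition_on_insert[OF this, of A] q
    show "(case q of (Q, B) \<Rightarrow> (B, Q - {B})) \<in>
        (SIGMA B:{B. B \<subseteq> A \<and> B \<noteq> {} \<and> c B}. {P. partition_on (A - B) P})"
      by (simp add: insert_absorb)
  next
    fix p assume "p \<in> (SIGMA B:{B. B \<subseteq> A \<and> B \<noteq> {} \<and> c B}. {P. partition_on (A - B) P})"
    then obtain B P where p: "p = (B, P)" "B \<subseteq> A" "B \<noteq> {}" "c B" "partition_on (A - B) P" by auto
    have dj: "disjnt B (\<Union>P)"
      using partition_onD1[OF p(5)] by (auto simp: disjnt_def)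
    have "B \<notin> P" using dj p(3) by (auto simp: disjnt_def)
    then show "(case (case p of (B, P) \<Rightarrow> (insert B P, B)) of (Q, B) \<Rightarrow> (B, Q - {B})) = p"
      using p(1) by simp
    show "(case p of (B, P) \<Rightarrow> (insert B P, B)) \<in> (SIGMA Q:{Q. partition_on A Q}. {B. B \<in> Q \<and> c B})"
      using p partition_on_insert[OF dj, of A] by simp
  qed (auto simp: insert_absorb)
  also have "\<dots> = (\<Sum>B | B \<subseteq> A \<and> B \<noteq> {} \<and> c B. \<Sum>P | partition_on (A - B) P. F B P)"
    using assms by (intro sum.Sigma[symmetric]) (auto intro: finitely_many_partition_on)
  finally show ?thesis .
qed

definition partition_sum :: "('a set \<Rightarrow> 'b::comm_ring_1) \<Rightarrow> 'a set \<Rightarrow> 'b" where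
  "partition_sum w A = (\<Sum>P | partition_on A P. \<Prod>S\<in>P. w S)"

lemma partition_sum_empty [simp]: "partition_sum w {} = 1"
  by (simp add: partition_sum_def partition_on_empty)

lemma blocks_containing_element:
  assumes "partition_on A Q" "a \<in> A"
  shows "\<exists>S. {B. B \<in> Q \<and> a \<in> B} = {S} \<and> S \<in> Q"
proof -
  obtain S where S: "S \<in> Q" "a \<in> S"
    using assms partition_onD1 by fastforce
  then have "{B. B \<in> Q \<and> a \<in> B} = {S}"
    using partition_onD2[OF assms(1)] by (auto simp: disjoint_def)
  then show ?thesis using S by blast
qed

text \<open>Every partition has exactly one block \<open>S\<close> that contains \<open>a\<close>, so distinguishing it does not
  change the sum.\<close>

lemma partition_sum_rec:
  assumes "finite A" "a \<in> A"
  shows "partition_sum w A = (\<Sum>S | S \<subseteq> A \<and> a \<in> S. w S * partition_sum w (A - S))"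
proof -
  have "partition_sum w A
      = (\<Sum>Q | partition_on A Q. \<Sum>B | B \<in> Q \<and> a \<in> B. w B * (\<Prod>S\<in>Q - {B}. w S))"
    unfolding partition_sum_def
  proof (rule sum.cong)
    fix Q assume "Q \<in> {Q. partition_on A Q}"
    then have Q: "partition_on A Q" by simp
    obtain S where "{B. B \<in> Q \<and> a \<in> B} = {S}" "S \<in> Q"
      using blocks_containing_element[OF Q assms(2)] by blast
    then show "(\<Prod>S\<in>Q. w S) = (\<Sum>B | B \<in> Q \<and> a \<in> B. w B * (\<Prod>S\<in>Q - {B}. w S))"
      using finite_elements[OF assms(1) Q] by (simp add: prod.remove)
  qed simp
  also have "\<dots> = (\<Sum>B | B \<subseteq> A \<and> B \<noteq> {} \<and> a \<in> B. w B * partition_sum w (A - B))"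
    using sum_marked_partitions[OF assms(1), where c = "\<lambda>B. a \<in> B" and F = "\<lambda>B P. w B * (\<Prod>S\<in>P. w S)"]
    by (simp add: partition_sum_def sum_distrib_left)
  also have "{B. B \<subseteq> A \<and> B \<noteq> {} \<and> a \<in> B} = {B. B \<subseteq> A \<and> a \<in> B}"
    by auto
  finally show ?thesis .
qed

section \<open>Inversion of partition sums\<close>

text \<open>The coefficient of \<open>P\<close> is the value of the Moebius function of the partition lattice on the
  interval from \<open>P\<close> to the one-block partition. The truncated subtraction affects only the
  empty partition, that is, only \<open>A = {}\<close>.\<close>

definition moebius_sum :: "('a set \<Rightarrow> 'b::{comm_ring_1, ring_char_0}) \<Rightarrow> 'a set \<Rightarrow> 'b" where
  "moebius_sum f A =
     (\<Sum>P | partition_on A P. (- 1) ^ (card P - 1) * fact (card P - 1) * (\<Prod>S\<in>P. f S))"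

text \<open>The terms with \<open>S \<noteq> A\<close> range over the partitions of \<open>A\<close> with a distinguished block \<open>A - S\<close>
  that avoids \<open>a\<close>. A partition with \<open>n\<close> blocks has \<open>n - 1\<close> such blocks and arises with the
  coefficient \<open>\<mu>(n - 1)\<close>, where \<open>\<mu>(n) = (- 1)\<^sup>n\<^sup>-\<^sup>1 (n - 1)!\<close>. Since
  \<open>(n - 1) \<mu>(n - 1) = - \<mu>(n)\<close> for \<open>n \<ge> 2\<close>, these terms cancel the term \<open>S = A\<close> except
  for the contribution \<open>f A\<close> of the one-block partition.\<close>

lemma moebius_sum_rec:
  fixes f :: "'a set \<Rightarrow> 'b::{comm_ring_1, ring_char_0}"
  assumes "finite A" "a \<in> A" "f {} = 1"
  shows "(\<Sum>S | S \<subseteq> A \<and> a \<in> S. moebius_sum f S * f (A - S)) = f A"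
proof -
  let ?\<mu> = "\<lambda>n. (- 1) ^ (n - 1) * fact (n - 1) :: 'b"
  have fin: "finite {S. S \<subseteq> A \<and> a \<in> S}" using assms by simp
  have "(\<Sum>S | S \<subseteq> A \<and> a \<in> S \<and> S \<noteq> A. moebius_sum f S * f (A - S))
      = (\<Sum>B | B \<subseteq> A \<and> B \<noteq> {} \<and> a \<notin> B. moebius_sum f (A - B) * f B)"
    by (rule sum.reindex_bij_witness[where i = "\<lambda>B. A - B" and j = "\<lambda>S. A - S"])
       (use assms in \<open>auto simp: double_diff\<close>)
  also have "\<dots> = (\<Sum>B | B \<subseteq> A \<and> B \<noteq> {} \<and> a \<notin> B. \<Sum>P | partition_on (A - B) P.
                    ?\<mu> (card P) * (\<Prod>S\<in>P. f S) * f B)"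
    by (simp add: moebius_sum_def sum_distrib_right)
  also have "\<dots> = (\<Sum>Q | partition_on A Q. \<Sum>B | B \<in> Q \<and> a \<notin> B.
                    ?\<mu> (card (Q - {B})) * (\<Prod>S\<in>Q - {B}. f S) * f B)"
    by (rule sum_marked_partitions[OF assms(1), symmetric])
  also have "\<dots> = (\<Sum>Q | partition_on A Q. (if Q = {A} then f A else 0) - ?\<mu> (card Q) * (\<Prod>S\<in>Q. f S))"
  proof (rule sum.cong)
    fix Q assume "Q \<in> {Q. partition_on A Q}"
    then have Q: "partition_on A Q" by simp
    have finQ: "finite Q" using finite_elements[OF assms(1) Q] .
    obtain S where S: "{B. B \<in> Q \<and> a \<in> B} = {S}" "S \<in> Q"
      using blocks_containing_element[OF Q assms(2)] by blast
    have rest: "{B. B \<in> Q \<and> a \<notin> B} = Q - {S}" using S by auto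
    have "(\<Sum>B | B \<in> Q \<and> a \<notin> B. ?\<mu> (card (Q - {B})) * (\<Prod>S\<in>Q - {B}. f S) * f B)
        = (\<Sum>B | B \<in> Q \<and> a \<notin> B. ?\<mu> (card Q - 1) * (\<Prod>S\<in>Q. f S))"
    proof (rule sum.cong)
      fix B assume "B \<in> {B. B \<in> Q \<and> a \<notin> B}"
      then have "prod f Q = f B * prod f (Q - {B})" "card (Q - {B}) = card Q - 1"
        using finQ by (simp_all add: prod.remove[of Q B])
      then show "?\<mu> (card (Q - {B})) * (\<Prod>S\<in>Q - {B}. f S) * f B = ?\<mu> (card Q - 1) * (\<Prod>S\<in>Q. f S)"
        by (simp only: mult_ac)
    qed simp
    also have "\<dots> = of_nat (card Q - 1) * ?\<mu> (card Q - 1) * (\<Prod>S\<in>Q. f S)"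
      using S(2) by (simp add: rest mult_ac)
    also have "\<dots> = (if Q = {A} then f A else 0) - ?\<mu> (card Q) * (\<Prod>S\<in>Q. f S)"
    proof (cases "card Q = 1")
      case True
      then have "Q = {S}" using S(2) by (auto simp: card_1_singleton_iff)
      then have "Q = {A}" using partition_onD1[OF Q] by simp
      then show ?thesis by simp
    next
      case False
      moreover have "card Q \<noteq> 0" using finQ S(2) by auto
      ultimately obtain m where m: "card Q = Suc (Suc m)"
        by (metis One_nat_def nat.exhaust)
      then have "Q \<noteq> {A}" by auto
      then show ?thesis using m by (simp add: fact_Suc[of m, where 'a = 'b] mult_ac del: fact_Suc of_nat_Suc)
    qed
    finally show "(\<Sum>B | B \<in> Q \<and> a \<notin> B. ?\<mu> (card (Q - {B})) * (\<Prod>S\<in>Q - {B}. f S) * f B)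
        = (if Q = {A} then f A else 0) - ?\<mu> (card Q) * (\<Prod>S\<in>Q. f S)" .
  qed simp
  also have "\<dots> = f A - moebius_sum f A"
    using assms finitely_many_partition_on[OF assms(1)] partition_on_space[of A]
    by (auto simp: sum_subtractf moebius_sum_def sum.delta')
  finally have proper: "(\<Sum>S | S \<subseteq> A \<and> a \<in> S \<and> S \<noteq> A. moebius_sum f S * f (A - S)) = f A - moebius_sum f A" .
  have split: "{S. S \<subseteq> A \<and> a \<in> S} = insert A {S. S \<subseteq> A \<and> a \<in> S \<and> S \<noteq> A}"
    using assms by auto
  show ?thesis
    using assms proper by (subst split, subst sum.insert) auto
qed

text \<open>By \<open>moebius_sum_rec\<close> and \<open>partition_sum_rec\<close> the two sides solve the same recursion. In it
  the value at \<open>A\<close> itself has the coefficient \<open>partition_sum w {} = 1\<close>, and all other values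
  belong to proper subsets.\<close>

theorem moebius_sum_partition_sum:
  fixes w :: "'a set \<Rightarrow> 'b::{comm_ring_1, ring_char_0}"
  assumes "finite A" "A \<noteq> {}"
  shows "moebius_sum (partition_sum w) A = w A"
  using assms
proof (induction rule: finite_psubset_induct)
  case (psubset A)
  let ?f = "partition_sum w"
  obtain a where a: "a \<in> A" using psubset.prems by blast
  let ?C = "{S. S \<subseteq> A \<and> a \<in> S}"
  have C: "finite ?C" "A \<in> ?C" using psubset.hyps a by auto
  have "moebius_sum ?f A + (\<Sum>S\<in>?C - {A}. moebius_sum ?f S * ?f (A - S))
      = (\<Sum>S\<in>?C. moebius_sum ?f S * ?f (A - S))"
    using C by (simp add: sum.remove[of ?C A])
  also have "\<dots> = (\<Sum>S\<in>?C. w S * ?f (A - S))"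
    using psubset.hyps a by (simp add: moebius_sum_rec partition_sum_rec[of A a w])
  also have "\<dots> = w A + (\<Sum>S\<in>?C - {A}. w S * ?f (A - S))"
    using C by (simp add: sum.remove[of ?C A])
  also have "(\<Sum>S\<in>?C - {A}. w S * ?f (A - S)) = (\<Sum>S\<in>?C - {A}. moebius_sum ?f S * ?f (A - S))"
  proof (rule sum.cong)
    fix S assume "S \<in> ?C - {A}"
    then have "S \<subset> A" "S \<noteq> {}" by auto
    then show "w S * ?f (A - S) = moebius_sum ?f S * ?f (A - S)"
      by (simp add: psubset.IH)
  qed simp
  finally show ?case by simp
qed

section \<open>Monochromatic blocks and the Polya urn\<close>

text \<open>\<open>c\<close> colours the positions. The factorial counts the cyclic orders of the block, so that sums of
  products of these weights over partitions count permutations whose cycles are monochromatic,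
  with one factor \<open>\<alpha> k\<close> for each cycle of colour \<open>k\<close>.\<close>

definition mono_weight :: "('c \<Rightarrow> real) \<Rightarrow> ('a \<Rightarrow> 'c) \<Rightarrow> 'a set \<Rightarrow> real" where
  "mono_weight \<alpha> c S =
     (if is_singleton (c ` S) then fact (card S - 1) * \<alpha> (the_elem (c ` S)) else 0)"

lemma mono_weight_singleton: "mono_weight \<alpha> c {b} = \<alpha> (c b)"
  by (simp add: mono_weight_def)

text \<open>The number of elements of \<open>S\<close> of the colour of \<open>b\<close> is \<open>card S\<close> or \<open>0\<close> when \<open>S\<close> is
  monochromatic. Writing the factor in this form covers matching, clashing and mixed colours at
  once and makes it additive in \<open>S\<close>.\<close>

lemma mono_weight_insert:
  assumes "finite S" "S \<noteq> {}" "b \<notin> S"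
  shows "mono_weight \<alpha> c (insert b S) = mono_weight \<alpha> c S * real (card {i \<in> S. c i = c b})"
proof (cases "is_singleton (c ` S)")
  case True
  then obtain k where k: "c ` S = {k}" by (auto simp: is_singleton_def)
  show ?thesis
  proof (cases "c b = k")
    case True
    have "{i \<in> S. c i = c b} = S" using k True by auto
    moreover have "card S = Suc (card S - 1)"
      using assms by (simp add: card_gt_0_iff)
    then have "fact (card S) = real (card S) * fact (card S - 1)"
      by (metis fact_Suc)
    ultimately show ?thesis using assms k True by (simp add: mono_weight_def)
  next
    case False
    then have "\<forall>i\<in>S. c i \<noteq> c b" using k by (metis imageI singletonD)
    then have none: "{i \<in> S. c i = c b} = {}" by auto
    have "\<not> is_singleton (insert (c b) {k})"
      using False by (auto simp: is_singleton_def doubleton_eq_iff)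
    then show ?thesis using k by (simp add: mono_weight_def none)
  qed
next
  case False
  have "\<not> is_singleton (insert (c b) (c ` S))"
  proof
    assume "is_singleton (insert (c b) (c ` S))"
    then obtain k where "insert (c b) (c ` S) = {k}" by (auto simp: is_singleton_def)
    then have "c ` S = {k}" using assms(2) by (metis image_is_empty subset_insertI subset_singletonD)
    then show False using False by (simp add: is_singleton_def)
  qed
  then show ?thesis using False by (simp add: mono_weight_def)
qed

text \<open>Fix \<open>a \<in> A\<close> and let \<open>S\<close> be the block of \<open>a\<close> with \<open>b\<close> removed. Either \<open>b\<close> lies outside of
  this block, and by induction it contributes the factor \<open>\<alpha> (c b)\<close> plus the number of elements of
  its colour in \<open>A - S\<close>; or it lies inside, and contributes the number of those in \<open>S\<close>. The two
  numbers add up to that for \<open>A\<close>, independently of \<open>S\<close>.\<close>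

lemma partition_sum_mono_weight_insert:
  assumes "finite A" "b \<notin> A"
  shows "partition_sum (mono_weight \<alpha> c) (insert b A)
       = (\<alpha> (c b) + real (card {i \<in> A. c i = c b})) * partition_sum (mono_weight \<alpha> c) A"
  using assms
proof (induction rule: finite_psubset_induct)
  case (psubset A)
  let ?w = "mono_weight \<alpha> c" and ?F = "partition_sum (mono_weight \<alpha> c)"
  let ?m = "\<lambda>S. real (card {i \<in> S. c i = c b})"
  show ?case
  proof (cases "A = {}")
    case True
    have "{S. S \<subseteq> {b} \<and> b \<in> S} = {{b}}" by auto
    then show ?thesis
      using True partition_sum_rec[of "{b}" b ?w] by (simp add: mono_weight_singleton)
  next
    case False
    then obtain a where a: "a \<in> A" by blast
    with psubset.prems have ab: "a \<noteq> b" by auto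
    let ?C = "{S. S \<subseteq> A \<and> a \<in> S}"
    have fin: "finite ?C" using psubset.hyps by simp
    \<comment> \<open>The blocks of \<open>a\<close> without and with \<open>b\<close>.\<close>
    have split: "{S. S \<subseteq> insert b A \<and> a \<in> S} = ?C \<union> insert b ` ?C"
    proof (intro set_eqI iffI)
      fix S assume S: "S \<in> {S. S \<subseteq> insert b A \<and> a \<in> S}"
      show "S \<in> ?C \<union> insert b ` ?C"
      proof (cases "b \<in> S")
        case True
        then have "S = insert b (S - {b})" "S - {b} \<in> ?C" using S ab by auto
        then show ?thesis by blast
      qed (use S in auto)
    qed auto
    have inj: "inj_on (insert b) ?C"
      using psubset.prems by (auto simp: inj_on_def)
    have "?F (insert b A) = (\<Sum>S | S \<subseteq> insert b A \<and> a \<in> S. ?w S * ?F (insert b A - S))"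
      using psubset.hyps a by (intro partition_sum_rec) auto
    also have "\<dots> = (\<Sum>S\<in>?C. ?w S * ?F (insert b A - S))
                  + (\<Sum>S\<in>?C. ?w (insert b S) * ?F (insert b A - insert b S))"
      using fin psubset.prems inj
      by (subst split, subst sum.union_disjoint) (auto simp: sum.reindex)
    also have "\<dots> = (\<Sum>S\<in>?C. (\<alpha> (c b) + ?m A) * (?w S * ?F (A - S)))"
      unfolding sum.distrib[symmetric]
    proof (rule sum.cong)
      fix S assume "S \<in> ?C"
      then have S: "S \<subseteq> A" "a \<in> S" "finite S" "b \<notin> S"
        using psubset.hyps psubset.prems by (auto intro: finite_subset)
      have "insert b A - S = insert b (A - S)" "insert b A - insert b S = A - S"
        using S psubset.prems by auto
      moreover have "?F (insert b (A - S)) = (\<alpha> (c b) + ?m (A - S)) * ?F (A - S)"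
        using S a psubset.prems by (intro psubset.IH) auto
      moreover have "?w (insert b S) = ?w S * ?m S"
        using S by (intro mono_weight_insert) auto
      moreover have "?m A = ?m (A - S) + ?m S"
      proof -
        have "{i \<in> A. c i = c b} = {i \<in> A - S. c i = c b} \<union> {i \<in> S. c i = c b}"
          using S by auto
        then have "card {i \<in> A. c i = c b} = card {i \<in> A - S. c i = c b} + card {i \<in> S. c i = c b}"
          using S psubset.hyps by (simp only:) (rule card_Un_disjoint, auto)
        then show ?thesis by simp
      qed
      ultimately show "?w S * ?F (insert b A - S) + ?w (insert b S) * ?F (insert b A - insert b S)
          = (\<alpha> (c b) + ?m A) * (?w S * ?F (A - S))"
        by (simp add: algebra_simps)
    qed simp
    also have "\<dots> = (\<alpha> (c b) + ?m A) * ?F A"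
      using psubset.hyps a by (simp add: partition_sum_rec[of A a ?w] sum_distrib_left)
    finally show ?thesis .
  qed
qed

theorem partition_sum_mono_weight:
  assumes "finite A" "finite I" "c ` A \<subseteq> I"
  shows "partition_sum (mono_weight \<alpha> c) A = (\<Prod>k\<in>I. pochhammer (\<alpha> k) (card {i \<in> A. c i = k}))"
  using assms(1,3)
proof (induction A rule: finite_induct)
  case empty
  then show ?case by simp
next
  case (insert b A)
  let ?p = "\<lambda>A k. pochhammer (\<alpha> k) (card {i \<in> A. c i = k})"
  have b: "c b \<in> I" using insert.prems by auto
  have same: "?p (insert b A) (c b) = (\<alpha> (c b) + real (card {i \<in> A. c i = c b})) * ?p A (c b)"
  proof -
    have "{i \<in> insert b A. c i = c b} = insert b {i \<in> A. c i = c b}" by auto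
    then show ?thesis using insert.hyps by (simp add: pochhammer_Suc mult.commute)
  qed
  have other: "?p (insert b A) k = ?p A k" if "k \<noteq> c b" for k
  proof -
    have "{i \<in> insert b A. c i = k} = {i \<in> A. c i = k}" using that by auto
    then show ?thesis by simp
  qed
  have "prod (?p (insert b A)) I
      = (\<alpha> (c b) + real (card {i \<in> A. c i = c b})) * prod (?p A) I"
  proof -
    have "prod (?p (insert b A)) I = ?p (insert b A) (c b) * prod (?p (insert b A)) (I - {c b})"
      using assms(2) b by (rule prod.remove)
    also have "prod (?p (insert b A)) (I - {c b}) = prod (?p A) (I - {c b})"
      by (intro prod.cong refl other) auto
    also have "?p (insert b A) (c b) * \<dots>
        = (\<alpha> (c b) + real (card {i \<in> A. c i = c b})) * (?p A (c b) * prod (?p A) (I - {c b}))"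
      by (simp only: same mult.assoc)
    also have "?p A (c b) * prod (?p A) (I - {c b}) = prod (?p A) I"
      using assms(2) b by (rule prod.remove[symmetric])
    finally show ?thesis .
  qed
  then show ?case
    using insert by (simp add: partition_sum_mono_weight_insert)
qed

section \<open>The Dirichlet integral\<close>

text \<open>The truncated power of the theory of convolutions. The explicit cut-off is needed because
  \<open>y powr p\<close> is not zero at negative \<open>y\<close>; it encodes the condition that all coordinates of
  a point of the simplex be positive.\<close>

definition pos_powr :: "real \<Rightarrow> real \<Rightarrow> real" where
  "pos_powr p y = (if y > 0 then y powr p else 0)"

lemma pos_powr_nonneg [simp]: "pos_powr p y \<ge> 0"
  by (simp add: pos_powr_def)

lemma pos_powr_measurable [measurable]: "pos_powr p \<in> borel_measurable borel"
  unfolding pos_powr_def by measurable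

text \<open>Up to Gamma factors the truncated powers form a semigroup under convolution. The substitution
  \<open>y = s u\<close> turns the integral into the Beta integral over the unit interval.\<close>

lemma pos_powr_convolution:
  assumes "a > 0" "b > 0"
  shows "(\<integral>\<^sup>+ y. ennreal (pos_powr (a - 1) y * pos_powr (b - 1) (s - y)) \<partial>lborel)
       = ennreal (Beta a b * pos_powr (a + b - 1) s)"
proof (cases "s > 0")
  case False
  then have "(\<lambda>y. ennreal (pos_powr (a - 1) y * pos_powr (b - 1) (s - y))) = (\<lambda>_. 0)"
    by (auto simp: pos_powr_def fun_eq_iff)
  then show ?thesis using False by (simp add: pos_powr_def)
next
  case True
  have "(\<integral>\<^sup>+ y. ennreal (pos_powr (a - 1) y * pos_powr (b - 1) (s - y)) \<partial>lborel)
      = ennreal s * (\<integral>\<^sup>+ u. ennreal (pos_powr (a - 1) (s * u) * pos_powr (b - 1) (s - s * u)) \<partial>lborel)"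
    using True by (subst nn_integral_real_affine[where c = s and t = 0]) auto
  also have "(\<lambda>u. ennreal (pos_powr (a - 1) (s * u) * pos_powr (b - 1) (s - s * u)))
      = (\<lambda>u. ennreal (s powr (a + b - 2)) *
             ennreal (indicator {0..1} u * (u powr (a - 1) * (1 - u) powr (b - 1))))"
  proof
    fix u :: real
    have "pos_powr (a - 1) (s * u) * pos_powr (b - 1) (s - s * u)
        = s powr (a + b - 2) * (indicator {0..1} u * (u powr (a - 1) * (1 - u) powr (b - 1)))"
    proof (cases "0 < u \<and> u < 1")
      case u: True
      have "s - s * u = s * (1 - u)" by (simp add: algebra_simps)
      moreover have "s powr (a + b - 2) = s powr (a - 1) * s powr (b - 1)"
        by (simp flip: powr_add)
      ultimately show ?thesis
        using u True by (simp add: pos_powr_def powr_mult)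
    next
      case u: False
      have "\<not> (0 < s * u \<and> 0 < s - s * u)"
        using u True by (auto simp: zero_less_mult_iff)
      then have "pos_powr (a - 1) (s * u) * pos_powr (b - 1) (s - s * u) = 0"
        by (auto simp: pos_powr_def)
      moreover have "u = 0 \<or> u = 1 \<or> u \<notin> {0..1}" using u by auto
      ultimately show ?thesis by (elim disjE) auto
    qed
    then show "ennreal (pos_powr (a - 1) (s * u) * pos_powr (b - 1) (s - s * u))
        = ennreal (s powr (a + b - 2)) *
             ennreal (indicator {0..1} u * (u powr (a - 1) * (1 - u) powr (b - 1)))"
      by (simp add: ennreal_mult')
  qed
  also have "ennreal s * (\<integral>\<^sup>+ u. ennreal (s powr (a + b - 2)) *
      ennreal (indicator {0..1} u * (u powr (a - 1) * (1 - u) powr (b - 1))) \<partial>lborel)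
      = ennreal s * (ennreal (s powr (a + b - 2)) * ennreal (Beta a b))"
  proof (subst nn_integral_cmult)
    have "integral\<^sup>N lborel (\<lambda>u. ennreal (indicator {0..1} u * (u powr (a - 1) * (1 - u) powr (b - 1))))
        = ennreal (Beta a b)"
      by (rule nn_integral_has_integral_lebesgue[OF _ has_integral_Beta_real[OF assms]]) auto
    then show "ennreal s * (ennreal (s powr (a + b - 2)) * integral\<^sup>N lborel (\<lambda>u. ennreal (indicator {0..1} u * (u powr (a - 1) * (1 - u) powr (b - 1)))))
        = ennreal s * (ennreal (s powr (a + b - 2)) * ennreal (Beta a b))" by simp
  qed measurable
  also have "\<dots> = ennreal (Beta a b * (s * s powr (a + b - 2)))"
    using True assms by (simp add: ennreal_mult[symmetric] Beta_def Gamma_real_pos less_imp_le mult_ac)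
  also have "s * s powr (a + b - 2) = pos_powr (a + b - 1) s"
    using True by (simp add: pos_powr_def powr_mult_base algebra_simps)
  finally show ?thesis .
qed

text \<open>The total mass \<open>t\<close> and the exponent \<open>b\<close> of the last coordinate are kept general for the
  induction: integrating out \<open>x j\<close> replaces \<open>b\<close> by \<open>a j + b\<close> and leaves an integral of the
  same form over the other coordinates.\<close>

lemma nn_integral_dirichlet:
  fixes a :: "'i \<Rightarrow> real"
  assumes "finite I" "\<And>i. i \<in> I \<Longrightarrow> a i > 0" "b > 0"
  shows "(\<integral>\<^sup>+ x. ennreal ((\<Prod>i\<in>I. pos_powr (a i - 1) (x i)) * pos_powr (b - 1) (t - (\<Sum>i\<in>I. x i)))
            \<partial>PiM I (\<lambda>_. lborel))
       = ennreal ((\<Prod>i\<in>I. Gamma (a i)) * Gamma b / Gamma ((\<Sum>i\<in>I. a i) + b)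
                  * pos_powr ((\<Sum>i\<in>I. a i) + b - 1) t)"
  using assms
proof (induction I arbitrary: b rule: finite_induct)
  case empty
  interpret product_sigma_finite "\<lambda>_::'i. lborel :: real measure" by standard
  have "Gamma b > 0" using empty.prems by (intro Gamma_real_pos) simp
  then show ?case by (simp add: nn_integral_empty PiM_empty nn_integral_count_space_finite)
next
  case (insert j I)
  interpret product_sigma_finite "\<lambda>_::'i. lborel :: real measure" by standard
  have aj: "a j > 0" using insert.prems by auto
  have G: "Gamma (a j + b) > 0"
    using aj insert.prems by (intro Gamma_real_pos add_pos_pos)
  have beta: "Beta (a j) b \<ge> 0"
    using aj insert.prems G by (simp add: Beta_def Gamma_real_pos less_imp_le)
  let ?p = "\<lambda>x. \<Prod>i\<in>I. pos_powr (a i - 1) (x i)"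
  have meas: "(\<lambda>x. ennreal ((\<Prod>i\<in>insert j I. pos_powr (a i - 1) (x i))
                * pos_powr (b - 1) (t - (\<Sum>i\<in>insert j I. x i))))
              \<in> borel_measurable (PiM (insert j I) (\<lambda>_. lborel))"
    using insert.hyps by measurable
  have inner: "(\<integral>\<^sup>+ y. ennreal ((\<Prod>i\<in>insert j I. pos_powr (a i - 1) ((x(j := y)) i))
          * pos_powr (b - 1) (t - (\<Sum>i\<in>insert j I. (x(j := y)) i))) \<partial>lborel)
      = ennreal (Beta (a j) b) *
        ennreal (?p x * pos_powr (a j + b - 1) (t - (\<Sum>i\<in>I. x i)))" for x
  proof -
    have "(\<Prod>i\<in>I. pos_powr (a i - 1) ((x(j := y)) i)) = ?p x" for y
      using insert.hyps by (intro prod.cong) auto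
    moreover have "(\<Sum>i\<in>I. (x(j := y)) i) = (\<Sum>i\<in>I. x i)" for y
      using insert.hyps by (intro sum.cong) auto
    ultimately have "(\<Prod>i\<in>insert j I. pos_powr (a i - 1) ((x(j := y)) i))
          * pos_powr (b - 1) (t - (\<Sum>i\<in>insert j I. (x(j := y)) i))
        = ?p x * (pos_powr (a j - 1) y * pos_powr (b - 1) ((t - (\<Sum>i\<in>I. x i)) - y))" for y
      using insert.hyps by (simp add: algebra_simps)
    then have "(\<integral>\<^sup>+ y. ennreal ((\<Prod>i\<in>insert j I. pos_powr (a i - 1) ((x(j := y)) i))
          * pos_powr (b - 1) (t - (\<Sum>i\<in>insert j I. (x(j := y)) i))) \<partial>lborel)
        = (\<integral>\<^sup>+ y. ennreal (?p x) * ennreal (pos_powr (a j - 1) y * pos_powr (b - 1) ((t - (\<Sum>i\<in>I. x i)) - y)) \<partial>lborel)"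
      by (simp only:) (simp add: ennreal_mult prod_nonneg)
    also have "\<dots> = ennreal (?p x) * ennreal (Beta (a j) b * pos_powr (a j + b - 1) (t - (\<Sum>i\<in>I. x i)))"
      using aj insert.prems by (subst nn_integral_cmult) (auto simp: pos_powr_convolution)
    also have "\<dots> = ennreal (Beta (a j) b) * ennreal (?p x * pos_powr (a j + b - 1) (t - (\<Sum>i\<in>I. x i)))"
    proof -
      have "ennreal p * ennreal (\<beta> * r) = ennreal \<beta> * ennreal (p * r)" if "p \<ge> 0" "\<beta> \<ge> 0" "r \<ge> 0" for p \<beta> r
        using that by (simp add: ennreal_mult mult_ac)
      then show ?thesis using beta by (simp add: prod_nonneg)
    qed
    finally show ?thesis .
  qed
  have "(\<integral>\<^sup>+ x. ennreal ((\<Prod>i\<in>insert j I. pos_powr (a i - 1) (x i))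
           * pos_powr (b - 1) (t - (\<Sum>i\<in>insert j I. x i))) \<partial>PiM (insert j I) (\<lambda>_. lborel))
      = (\<integral>\<^sup>+ x. ennreal (Beta (a j) b) *
           ennreal (?p x * pos_powr (a j + b - 1) (t - (\<Sum>i\<in>I. x i))) \<partial>PiM I (\<lambda>_. lborel))"
    unfolding product_nn_integral_insert[OF insert.hyps meas] by (simp only: inner)
  also have "\<dots> = ennreal (Beta (a j) b) *
      ennreal ((\<Prod>i\<in>I. Gamma (a i)) * Gamma (a j + b) / Gamma ((\<Sum>i\<in>I. a i) + (a j + b))
                  * pos_powr ((\<Sum>i\<in>I. a i) + (a j + b) - 1) t)"
    using aj insert.prems insert.hyps
    by (subst nn_integral_cmult) (measurable, subst insert.IH, auto intro: add_pos_pos)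
  also have "\<dots> = ennreal (Beta (a j) b * ((\<Prod>i\<in>I. Gamma (a i)) * Gamma (a j + b)
                  / Gamma ((\<Sum>i\<in>I. a i) + (a j + b)) * pos_powr ((\<Sum>i\<in>I. a i) + (a j + b) - 1) t))"
    by (rule ennreal_mult'[symmetric]) (rule beta)
  also have "Beta (a j) b * ((\<Prod>i\<in>I. Gamma (a i)) * Gamma (a j + b)
                  / Gamma ((\<Sum>i\<in>I. a i) + (a j + b)) * pos_powr ((\<Sum>i\<in>I. a i) + (a j + b) - 1) t)
      = (\<Prod>i\<in>insert j I. Gamma (a i)) * Gamma b / Gamma ((\<Sum>i\<in>insert j I. a i) + b)
                  * pos_powr ((\<Sum>i\<in>insert j I. a i) + b - 1) t"
    using G insert.hyps by (simp add: Beta_def add_ac field_simps)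
  finally show ?case .
qed

section \<open>Moments of the Dirichlet distribution\<close>

lemma simplex_point_measurable [measurable]:
  assumes "K \<ge> 1"
  shows "simplex_point K \<in> PiM {1..<K} (\<lambda>_. lborel) \<rightarrow>\<^sub>M PiM {1..K} (\<lambda>_. borel)"
proof -
  have *: "{1..K} = insert K {1..<K}" using assms by auto
  have 1: "(\<lambda>x. x(K := 1 - (\<Sum>k\<in>{1..<K}. x k)))
      \<in> PiM {1..<K} (\<lambda>_. lborel) \<rightarrow>\<^sub>M PiM (insert K {1..<K}) (\<lambda>_. borel :: real measure)"
  proof (rule measurable_fun_upd[where J = "{1..<K}"])
    show "(\<lambda>x. x) \<in> PiM {1..<K} (\<lambda>_. lborel) \<rightarrow>\<^sub>M PiM {1..<K} (\<lambda>_. borel :: real measure)"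
      by (subst measurable_cong_sets[OF refl sets_PiM_cong[OF refl, of _ _ "\<lambda>_. lborel"]]) auto
  qed (auto intro: borel_measurable_diff borel_measurable_sum)
  show ?thesis unfolding simplex_point_def[abs_def] * by (rule 1)
qed

text \<open>The monomial raises the exponent of coordinate \<open>k\<close> by the multiplicity \<open>m k\<close> of \<open>k\<close> in the
  multi-index, so that the moment is the quotient of the Dirichlet integrals with parameters
  \<open>\<alpha> + m\<close> and \<open>\<alpha>\<close>. Each quotient \<open>Gamma (z + j) / Gamma z\<close> is a rising factorial.\<close>

lemma moment_tensor_eq:
  fixes n :: nat and \<alpha> :: "nat \<Rightarrow> real" and ks :: "nat list"
  defines "m \<equiv> \<lambda>k. card {i \<in> {..<n}. ks ! i = k}"
  assumes K: "K \<ge> 1" and pos: "\<forall>k\<in>{1..K}. \<alpha> k > 0"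
    and ks: "length ks = n" "set ks \<subseteq> {1..K}"
  shows "moment_tensor K \<alpha> n ks
       = (\<Prod>k=1..K. pochhammer (\<alpha> k) (m k)) / pochhammer (\<Sum>k=1..K. \<alpha> k) n"
proof -
  let ?C = "Gamma (\<Sum>k=1..K. \<alpha> k) / (\<Prod>k=1..K. Gamma (\<alpha> k))"
  let ?M = "PiM {1..<K} (\<lambda>_. lborel :: real measure)"
  let ?a = "\<lambda>k. \<alpha> k + real (m k)"
  have Kset: "{1..K} = insert K {1..<K}" using K by auto
  have abar: "(\<Sum>k=1..K. \<alpha> k) > 0" using pos K by (intro sum_pos) auto
  have C: "?C \<ge> 0" using pos abar
    by (intro divide_nonneg_nonneg prod_nonneg) (auto intro!: less_imp_le Gamma_real_pos)
  have a_pos: "?a k > 0" if "k \<in> {1..K}" for k using pos that by (simp add: add_pos_nonneg)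
  have sum_m: "(\<Sum>k=1..K. m k) = n"
  proof -
    have "(\<Sum>k=1..K. m k) = (\<Sum>k=1..K. \<Sum>i\<in>{i \<in> {..<n}. ks ! i = k}. 1)"
      by (simp add: m_def)
    also have "\<dots> = (\<Sum>i<n. 1)"
      using ks nth_mem by (intro sum.group) fastforce+
    finally show ?thesis by simp
  qed
  have prod_m: "(\<Prod>i<n. q (ks ! i)) = (\<Prod>k=1..K. q k ^ m k)" for q :: "nat \<Rightarrow> real"
  proof -
    have "(\<Prod>k=1..K. q k ^ m k) = (\<Prod>k=1..K. \<Prod>i\<in>{i \<in> {..<n}. ks ! i = k}. q (ks ! i))"
      by (simp add: m_def)
    also have "\<dots> = (\<Prod>i<n. q (ks ! i))"
      using ks nth_mem by (intro prod.group) fastforce+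
    finally show ?thesis by simp
  qed
  have density: "dirichlet_density K \<alpha> q = ?C * (\<Prod>k=1..K. pos_powr (\<alpha> k - 1) (q k))" for q
  proof (cases "\<forall>k\<in>{1..K}. q k > 0")
    case True
    then show ?thesis by (simp add: dirichlet_density_def pos_powr_def)
  next
    case False
    then obtain k where "k \<in> {1..K}" "\<not> q k > 0" by blast
    then have "(\<Prod>k=1..K. pos_powr (\<alpha> k - 1) (q k)) = 0"
      by (intro prod_zero) (auto simp: pos_powr_def)
    then show ?thesis using False by (auto simp: dirichlet_density_def)
  qed
  have integrand: "dirichlet_density K \<alpha> q * (\<Prod>i<n. q (ks ! i))
      = ?C * (\<Prod>k=1..K. pos_powr (?a k - 1) (q k))" for q
  proof -
    have "pos_powr (\<alpha> k - 1) y * y ^ m k = pos_powr (?a k - 1) y" for k y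
      by (simp add: pos_powr_def powr_add[symmetric] powr_realpow[symmetric] algebra_simps)
    then have "(\<Prod>k=1..K. pos_powr (\<alpha> k - 1) (q k)) * (\<Prod>k=1..K. q k ^ m k)
        = (\<Prod>k=1..K. pos_powr (?a k - 1) (q k))"
      by (simp flip: prod.distrib)
    then show ?thesis by (simp add: density prod_m mult.assoc)
  qed
  have coord: "(\<lambda>q. q (ks ! i)) \<in> borel_measurable (PiM {1..K} (\<lambda>_. borel :: real measure))" if "i < n" for i
    using that ks nth_mem by (intro measurable_component_singleton) fastforce
  have mon: "(\<lambda>q. \<Prod>i<n. q (ks ! i)) \<in> borel_measurable (PiM {1..K} (\<lambda>_. borel :: real measure))"
    using coord by (intro borel_measurable_prod) auto
  have dens_meas: "dirichlet_density K \<alpha> \<in> borel_measurable (PiM {1..K} (\<lambda>_. borel))"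
    unfolding density[abs_def] by measurable
  note sp = simplex_point_measurable[OF K]
  have "moment_tensor K \<alpha> n ks
      = (\<integral>x. (\<Prod>i<n. simplex_point K x (ks ! i))
            \<partial>density ?M (\<lambda>x. ennreal (dirichlet_density K \<alpha> (simplex_point K x))))"
    unfolding moment_tensor_def dirichlet_def using sp mon by (subst integral_distr) auto
  also have "\<dots> = (\<integral>x. dirichlet_density K \<alpha> (simplex_point K x) * (\<Prod>i<n. simplex_point K x (ks ! i)) \<partial>?M)"
  proof (subst integral_density)
    show "AE x in ?M. 0 \<le> dirichlet_density K \<alpha> (simplex_point K x)"
      unfolding density using C by (intro AE_I2 mult_nonneg_nonneg prod_nonneg) auto
  qed (use measurable_compose[OF sp mon] measurable_compose[OF sp dens_meas] in simp_all)
  also have "\<dots> = ?C * (\<integral>x. (\<Prod>k=1..K. pos_powr (?a k - 1) (simplex_point K x k)) \<partial>?M)"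
    unfolding integrand by simp
  also have "(\<integral>x. (\<Prod>k=1..K. pos_powr (?a k - 1) (simplex_point K x k)) \<partial>?M)
      = (\<Prod>k=1..K. Gamma (?a k)) / Gamma (\<Sum>k=1..K. ?a k)"
  proof -
    have sp_prod: "(\<Prod>k=1..K. pos_powr (?a k - 1) (simplex_point K x k))
        = (\<Prod>k\<in>{1..<K}. pos_powr (?a k - 1) (x k)) * pos_powr (?a K - 1) (1 - (\<Sum>k\<in>{1..<K}. x k))" for x
      unfolding Kset by (simp add: simplex_point_def mult.commute)
    have sum_split: "(\<Sum>k\<in>{1..<K}. ?a k) + ?a K = (\<Sum>k=1..K. ?a k)"
      and prod_split: "(\<Prod>k\<in>{1..<K}. Gamma (?a k)) * Gamma (?a K) = (\<Prod>k=1..K. Gamma (?a k))"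
      unfolding Kset by (simp_all add: add.commute mult.commute)
    have nn: "(\<integral>\<^sup>+x. ennreal (\<Prod>k=1..K. pos_powr (?a k - 1) (simplex_point K x k)) \<partial>?M)
        = ennreal ((\<Prod>k=1..K. Gamma (?a k)) / Gamma (\<Sum>k=1..K. ?a k))"
    proof -
      have "pos_powr p 1 = 1" for p by (simp add: pos_powr_def)
      moreover have "(\<integral>\<^sup>+x. ennreal ((\<Prod>k\<in>{1..<K}. pos_powr (?a k - 1) (x k)) *
            pos_powr (?a K - 1) (1 - (\<Sum>k\<in>{1..<K}. x k))) \<partial>?M)
          = ennreal ((\<Prod>k\<in>{1..<K}. Gamma (?a k)) * Gamma (?a K) / Gamma ((\<Sum>k\<in>{1..<K}. ?a k) + ?a K)
                  * pos_powr ((\<Sum>k\<in>{1..<K}. ?a k) + ?a K - 1) 1)"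
        using a_pos K by (intro nn_integral_dirichlet) auto
      ultimately show ?thesis
        by (simp only: sp_prod sum_split prod_split mult_1_right)
    qed
    have "(\<integral>x. (\<Prod>k=1..K. pos_powr (?a k - 1) (simplex_point K x k)) \<partial>?M)
        = enn2real (\<integral>\<^sup>+x. ennreal (\<Prod>k=1..K. pos_powr (?a k - 1) (simplex_point K x k)) \<partial>?M)"
    proof (rule integral_eq_nn_integral)
      show "(\<lambda>x. \<Prod>k=1..K. pos_powr (?a k - 1) (simplex_point K x k)) \<in> borel_measurable ?M"
        unfolding sp_prod by measurable
    qed (simp add: prod_nonneg)
    also have "\<dots> = (\<Prod>k=1..K. Gamma (?a k)) / Gamma (\<Sum>k=1..K. ?a k)"
      unfolding nn using a_pos K
      by (intro enn2real_ennreal divide_nonneg_nonneg prod_nonneg ballI less_imp_le Gamma_real_pos sum_pos) auto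
    finally show ?thesis .
  qed
  also have "(\<Sum>k=1..K. ?a k) = (\<Sum>k=1..K. \<alpha> k) + real n"
    by (simp only: sum.distrib sum_m flip: of_nat_sum)
  also have "?C * ((\<Prod>k=1..K. Gamma (?a k)) / Gamma ((\<Sum>k=1..K. \<alpha> k) + real n))
      = (\<Prod>k=1..K. Gamma (?a k) / Gamma (\<alpha> k)) / (Gamma ((\<Sum>k=1..K. \<alpha> k) + real n) / Gamma (\<Sum>k=1..K. \<alpha> k))"
    by (simp add: prod_dividef)
  also have "\<dots> = (\<Prod>k=1..K. pochhammer (\<alpha> k) (m k)) / pochhammer (\<Sum>k=1..K. \<alpha> k) n"
  proof -
    have "Gamma (z + real j) / Gamma z = pochhammer z j" if "z > 0" for z j
      using that by (subst pochhammer_Gamma) (auto elim!: nonpos_Ints_cases)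
    then show ?thesis using pos abar by simp
  qed
  finally show ?thesis .
qed

section \<open>Tensor entries as block weights\<close>

lemma length_nths_subset:
  assumes "S \<subseteq> {..<length ks}"
  shows "length (nths ks S) = card S"
proof -
  have "{i. i < length ks \<and> i \<in> S} = S" using assms by auto
  then show ?thesis by (simp add: length_nths)
qed

text \<open>The factor \<open>s\<close>, one for each block, is where the powers of \<open>\<Sum>\<alpha>\<close> in the first formula go: it
  undoes the normalisation of \<open>\<alpha>\<close>.\<close>

lemma diag_tensor_nths:
  fixes \<alpha> :: "nat \<Rightarrow> real"
  assumes S: "S \<subseteq> {..<length ks}" "S \<noteq> {}" and "s \<noteq> 0"
  shows "s * (fact (card S - 1) * diag_tensor (card S) (\<lambda>k. \<alpha> k / s) (nths ks S))
       = mono_weight \<alpha> ((!) ks) S"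
proof -
  let ?xs = "nths ks S"
  have len: "length ?xs = card S" by (rule length_nths_subset[OF S(1)])
  have set: "set ?xs = (!) ks ` S" using S(1) by (auto simp: set_nths)
  have "finite S" using S(1) finite_subset by blast
  then have ne: "?xs ! 0 \<in> set ?xs" using S(2) len by (intro nth_mem) (simp add: card_gt_0_iff)
  show ?thesis
  proof (cases "\<forall>i<card S. ?xs ! i = ?xs ! 0")
    case True
    then have "set ?xs = {?xs ! 0}" using ne len by (auto simp: set_conv_nth)
    then have "mono_weight \<alpha> ((!) ks) S = fact (card S - 1) * \<alpha> (?xs ! 0)"
      unfolding mono_weight_def set[symmetric] by (metis is_singletonI the_elem_eq)
    moreover have "diag_tensor (card S) (\<lambda>k. \<alpha> k / s) ?xs = \<alpha> (?xs ! 0) / s"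
      unfolding diag_tensor_def by (rule if_P[OF True])
    ultimately show ?thesis using \<open>s \<noteq> 0\<close> by simp
  next
    case False
    then obtain i where i: "i < card S" "?xs ! i \<noteq> ?xs ! 0" by blast
    then have "?xs ! i \<in> set ?xs" using len by simp
    with ne i(2) have "\<not> is_singleton (set ?xs)"
      by (auto simp: is_singleton_def)
    then show ?thesis using False by (auto simp: diag_tensor_def mono_weight_def set)
  qed
qed

text \<open>The multiplicity of a value in the sub-multi-index at \<open>S\<close> is the number of positions in \<open>S\<close> of
  that colour, so the closed form of the moment agrees with that of the partition sum.\<close>

lemma moment_tensor_nths:
  fixes \<alpha> :: "nat \<Rightarrow> real"
  assumes K: "K \<ge> 1" and pos: "\<forall>k\<in>{1..K}. \<alpha> k > 0"
    and ks: "set ks \<subseteq> {1..K}" and S: "S \<subseteq> {..<length ks}"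
  shows "pochhammer (\<Sum>k=1..K. \<alpha> k) (card S) * moment_tensor K \<alpha> (card S) (nths ks S)
       = partition_sum (mono_weight \<alpha> ((!) ks)) S"
proof -
  let ?xs = "nths ks S"
  have len: "length ?xs = card S" by (rule length_nths_subset[OF S])
  have abar: "(\<Sum>k=1..K. \<alpha> k) > 0" using pos K by (intro sum_pos) auto
  have fin: "finite S" using S finite_subset by blast
  have count: "card {i \<in> {..<card S}. ?xs ! i = k} = card {i \<in> S. ks ! i = k}" for k
  proof -
    have "card {i \<in> {..<card S}. ?xs ! i = k} = count (mset ?xs) k"
      by (simp add: count_mset count_list_eq_length_filter length_filter_conv_card len eq_commute)
    also have "mset ?xs = image_mset ((!) ks) (mset_set S)"
    proof -
      have "{i. i < length ks \<and> i \<in> S} = S" using S by auto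
      then show ?thesis by (simp add: mset_nths_eq)
    qed
    also have "count \<dots> k = card {i \<in> S. ks ! i = k}"
      using fin by (simp add: count_image_mset_eq_card_vimage)
    finally show ?thesis .
  qed
  have xs: "set ?xs \<subseteq> {1..K}" using ks set_nths_subset[of ks S] by blast
  have "moment_tensor K \<alpha> (card S) ?xs
      = (\<Prod>k=1..K. pochhammer (\<alpha> k) (card {i \<in> S. ks ! i = k})) / pochhammer (\<Sum>k=1..K. \<alpha> k) (card S)"
    using moment_tensor_eq[OF K pos len xs] by (simp only: count)
  also have "(\<Prod>k=1..K. pochhammer (\<alpha> k) (card {i \<in> S. ks ! i = k}))
      = partition_sum (mono_weight \<alpha> ((!) ks)) S"
  proof (rule partition_sum_mono_weight[symmetric])
    show "(!) ks ` S \<subseteq> {1..K}"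
    proof (rule image_subsetI)
      fix i assume "i \<in> S"
      then have "ks ! i \<in> set ks" using S by (intro nth_mem) auto
      then show "ks ! i \<in> {1..K}" using ks by blast
    qed
  qed (use fin in simp_all)
  finally show ?thesis using pochhammer_pos[OF abar, of "card S"] by simp
qed

text \<open>For \<open>N \<ge> 1\<close> the number of blocks lies between \<open>1\<close> and \<open>N\<close>, so summing over it exhausts
  all partitions.\<close>

lemma sum_set_partitions:
  assumes "N \<ge> 1"
  shows "(\<Sum>n=1..N. \<Sum>P\<in>set_partitions N n. h n P) = (\<Sum>P | partition_on {..<N} P. h (card P) P)"
proof -
  have fin: "finite {P. partition_on {..<N} P}" by (rule finitely_many_partition_on) simp
  have card: "card P \<in> {1..N}" if "partition_on {..<N} P" for P
  proof -
    have P: "finite P" using finite_elements[OF _ that] by simp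
    have "0 \<in> \<Union>P" using partition_onD1[OF that] assms by auto
    then have "P \<noteq> {}" by auto
    then have "card P \<ge> 1" using P by (simp add: Suc_le_eq card_gt_0_iff)
    moreover have "card P \<le> N"
    proof -
      have "card P = (\<Sum>S\<in>P. 1)" by simp
      also have "\<dots> \<le> (\<Sum>S\<in>P. card S)"
      proof (rule sum_mono)
        fix S assume "S \<in> P"
        then have "S \<noteq> {}" "finite S" using that
          by (auto simp: partition_on_def intro: finite_subset[of _ "{..<N}"])
        then show "1 \<le> card S" by (simp add: Suc_le_eq card_gt_0_iff)
      qed
      also have "\<dots> = card {..<N}"
        using that by (intro product_partition[symmetric])
          (auto simp: partition_on_def intro: finite_subset[of _ "{..<N}"])
      finally show ?thesis by simp
    qed
    ultimately show ?thesis by simp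
  qed
  have "(\<Sum>n=1..N. \<Sum>P\<in>set_partitions N n. h n P)
      = (\<Sum>n=1..N. \<Sum>P\<in>{P \<in> {P. partition_on {..<N} P}. card P = n}. h (card P) P)"
    by (simp add: set_partitions_def)
  also have "\<dots> = (\<Sum>P | partition_on {..<N} P. h (card P) P)"
    using fin card by (intro sum.group) auto
  finally show ?thesis .
qed

text \<open>Block by block, the diagonal tensors become the weights \<open>w\<close> and the moment tensors the partition
  sums of \<open>w\<close>. The two claims are then the closed form of the partition sum over all positions and
  its Moebius inversion.\<close>

theorem lemma1:
  fixes K N :: nat and \<alpha> :: "nat \<Rightarrow> real"
  defines "\<alpha>bar \<equiv> (\<Sum>k=1..K. \<alpha> k)"
  defines "\<alpha>tilde \<equiv> (\<lambda>k. \<alpha> k / \<alpha>bar)"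
  assumes "K \<ge> 1" and "N \<ge> 1"
    and "\<forall>k\<in>{1..K}. \<alpha> k > 0"
  shows "(\<forall>ks. length ks = N \<and> set ks \<subseteq> {1..K} \<longrightarrow>
           moment_tensor K \<alpha> N ks =
             1 / pochhammer \<alpha>bar N *
             (\<Sum>n=1..N. \<alpha>bar ^ n *
               (\<Sum>P\<in>set_partitions N n. (\<Prod>S\<in>P. fact (card S - 1)) *
                 block_tensor P (\<lambda>S. diag_tensor (card S) \<alpha>tilde) ks)))
       \<and> (\<forall>ks. length ks = N \<and> set ks \<subseteq> {1..K} \<longrightarrow>
           diag_tensor N \<alpha>tilde ks =
             1 / (fact (N - 1) * \<alpha>bar) *
             (\<Sum>n=1..N. (-1) ^ (n - 1) * fact (n - 1) *
               (\<Sum>P\<in>set_partitions N n. (\<Prod>S\<in>P. pochhammer \<alpha>bar (card S)) *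
                 block_tensor P (\<lambda>S. moment_tensor K \<alpha> (card S)) ks)))"
proof (intro conjI allI impI; elim conjE)
  have abar: "\<alpha>bar > 0" unfolding \<alpha>bar_def using assms(3,5) by (intro sum_pos) auto
  fix ks :: "nat list"
  assume ks: "length ks = N" "set ks \<subseteq> {1..K}"
  let ?w = "mono_weight \<alpha> ((!) ks)"
  have full: "nths ks {..<N} = ks" using ks(1) by (simp add: nths_all)
  have blocks: "S \<subseteq> {..<length ks}" "S \<noteq> {}" if "partition_on {..<N} P" "S \<in> P" for P S
    using that ks(1) by (auto simp: partition_on_def)
  note moment = moment_tensor_nths[OF assms(3,5) ks(2), folded \<alpha>bar_def]
  note diag = diag_tensor_nths[where s = \<alpha>bar and \<alpha> = \<alpha> and ks = ks, folded \<alpha>tilde_def]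
  {
    have "\<alpha>bar ^ card P * ((\<Prod>S\<in>P. fact (card S - 1)) *
        block_tensor P (\<lambda>S. diag_tensor (card S) \<alpha>tilde) ks) = (\<Prod>S\<in>P. ?w S)"
      if P: "partition_on {..<N} P" for P
    proof -
      have "(\<Prod>S\<in>P. ?w S)
          = (\<Prod>S\<in>P. \<alpha>bar * (fact (card S - 1) * diag_tensor (card S) \<alpha>tilde (nths ks S)))"
        using blocks[OF P] abar by (intro prod.cong refl diag[symmetric]) auto
      then show ?thesis by (simp add: block_tensor_def prod.distrib)
    qed
    then have "(\<Sum>n=1..N. \<alpha>bar ^ n * (\<Sum>P\<in>set_partitions N n. (\<Prod>S\<in>P. fact (card S - 1)) *
                 block_tensor P (\<lambda>S. diag_tensor (card S) \<alpha>tilde) ks))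
        = partition_sum ?w {..<N}"
      unfolding sum_distrib_left sum_set_partitions[OF assms(4)] partition_sum_def
      by (intro sum.cong) auto
    moreover have "pochhammer \<alpha>bar N * moment_tensor K \<alpha> N ks = partition_sum ?w {..<N}"
      using moment[of "{..<N}"] ks(1) full by simp
    ultimately show "moment_tensor K \<alpha> N ks = 1 / pochhammer \<alpha>bar N *
             (\<Sum>n=1..N. \<alpha>bar ^ n *
               (\<Sum>P\<in>set_partitions N n. (\<Prod>S\<in>P. fact (card S - 1)) *
                 block_tensor P (\<lambda>S. diag_tensor (card S) \<alpha>tilde) ks))"
      using pochhammer_pos[OF abar, of N] by (simp add: field_simps)
  }
  {
    have "(\<Prod>S\<in>P. pochhammer \<alpha>bar (card S)) * block_tensor P (\<lambda>S. moment_tensor K \<alpha> (card S)) ks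
        = (\<Prod>S\<in>P. partition_sum ?w S)" if P: "partition_on {..<N} P" for P
      unfolding block_tensor_def prod.distrib[symmetric]
      using blocks[OF P] by (intro prod.cong) (auto simp: moment)
    then have "(\<Sum>n=1..N. (-1) ^ (n - 1) * fact (n - 1) *
               (\<Sum>P\<in>set_partitions N n. (\<Prod>S\<in>P. pochhammer \<alpha>bar (card S)) *
                 block_tensor P (\<lambda>S. moment_tensor K \<alpha> (card S)) ks))
        = moebius_sum (partition_sum ?w) {..<N}"
      unfolding sum_distrib_left sum_set_partitions[OF assms(4)] moebius_sum_def
      by (intro sum.cong) auto
    also have "\<dots> = ?w {..<N}"
      using assms(4) by (intro moebius_sum_partition_sum) (auto simp: lessThan_empty_iff)
    also have "\<dots> = \<alpha>bar * (fact (N - 1) * diag_tensor N \<alpha>tilde ks)"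
      using diag[of "{..<N}"] ks(1) full abar assms(4) by (simp add: lessThan_empty_iff)
    finally show "diag_tensor N \<alpha>tilde ks = 1 / (fact (N - 1) * \<alpha>bar) *
             (\<Sum>n=1..N. (-1) ^ (n - 1) * fact (n - 1) *
               (\<Sum>P\<in>set_partitions N n. (\<Prod>S\<in>P. pochhammer \<alpha>bar (card S)) *
                 block_tensor P (\<lambda>S. moment_tensor K \<alpha> (card S)) ks))"
      using abar by (simp add: field_simps)
  }
qed

end
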